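(* There is a polynomial $p$ such that for every integer $n\ge1$ there exists a probability distribution $\mathcal{D}$ with full support on $\mathcal{G}_n$ such that, for $F\sim\mathcal{D}$, computing the expectation-complete graph embedding $\varphi^{\downarrow}_F(G)=\hom_{v(G)}(F,G)\,e_F$ takes expected time at most $p(v(G))$, i.e. polynomial time in $v(G)$ in expectation, for all $G\in\mathcal{G}_n$.
   Context: Graphs are finite, undirected and simple, with at least one vertex; $v(G)$ is the number of vertices of $G$ and $\mathrm{tw}(F)$ is the treewidth of $F$. $\mathcal{G}_n$ is the set of all graphs with at most $n$ vertices, considered up to isomorphism (one representative per class), hence finite. $\hom(F,G)$ is the number of graph homomorphisms (edge-preserving maps $V(F)\to V(G)$); $\hom_{v(G)}(F,G)=\hom(F,G)$ if $v(F)\le v(G)$ and $0$ if $v(F)>v(G)$. $e_F\in\mathbb{R}^{\mathcal{G}_n}$ is the standard basis vector indexed by $F$. A distribution has full support on $\mathcal{G}_n$ if each element of $\mathcal{G}_n$ has nonzero probability. A random embedding $\varphi_X$ is expectation-complete on $\mathcal{G}_n$ if $G\mapsto\mathbb{E}_X[\varphi_X(G)]$ takes equal values on isomorphic graphs and different values on non-isomorphic graphs. Running time convention: for a given pattern $F$, the cost of computing the embedding is the cost of the homomorphism count; $\hom(F,G)$ is computed by the known algorithm of Díaz, Serna and Thilikos (2002) in time $O(v(F)\,v(G)^{\mathrm{tw}(F)+1})$ (with an absolute constant), and if $v(F)>v(G)$ the value is $0$ and no homomorphism count has to be computed (constant cost). The expectation is over $F\sim\mathcal{D}$. *)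

theory Defs
  imports
    "Graph_Theory.Pair_Digraph"
    "Graph_Theory.Digraph_Component"
    "Graph_Theory.Digraph_Isomorphism"
    "HOL-Probability.Probability_Mass_Function"
    "HOL-Computational_Algebra.Polynomial"
begin

section \<open>Graphs up to isomorphism\<close>

text \<open>
  An undirected graph is a symmetric, loop-free pair digraph: the edge between u and w is
  present as both arcs (u, w) and (w, u). Vertices are natural numbers, which covers all
  finite graphs up to isomorphism.
\<close>

type_synonym ngraph = "nat pair_pre_digraph"

definition simple_graph :: "'a pair_pre_digraph \<Rightarrow> bool" where
  "simple_graph G \<longleftrightarrow> pair_graph G \<and> pverts G \<noteq> {}"

definition vcount :: "'a pair_pre_digraph \<Rightarrow> nat" where
  "vcount G = card (pverts G)"

definition isomorphic :: "'a pair_pre_digraph \<Rightarrow> 'b pair_pre_digraph \<Rightarrow> bool" where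
  "isomorphic G H \<longleftrightarrow> digraph_iso (with_proj G) (with_proj H)"

definition graphs_upto :: "nat \<Rightarrow> ngraph set" where
  "graphs_upto n = {G. simple_graph G \<and> vcount G \<le> n}"

text \<open>
  The chosen representative of an isomorphism class; isomorphic graphs have the same one
  (see \<open>isomorphic_iff_canonical\<close> below).
\<close>

definition canonical :: "ngraph \<Rightarrow> ngraph" where
  "canonical G = (SOME H. simple_graph H \<and> isomorphic G H)"

definition graph_reps :: "nat \<Rightarrow> ngraph set" (\<open>\<G>\<close>) where
  "\<G> n = canonical ` graphs_upto n"


section \<open>Homomorphism counts\<close>

definition homs :: "'a pair_pre_digraph \<Rightarrow> 'b pair_pre_digraph \<Rightarrow> ('a \<Rightarrow> 'b) set" where
  "homs F G = {f \<in> pverts F \<rightarrow>\<^sub>E pverts G. \<forall>(u, w) \<in> parcs F. (f u, f w) \<in> parcs G}"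

definition hom_count :: "'a pair_pre_digraph \<Rightarrow> 'b pair_pre_digraph \<Rightarrow> nat" where
  "hom_count F G = card (homs F G)"

definition hom_count_upto :: "nat \<Rightarrow> 'a pair_pre_digraph \<Rightarrow> 'b pair_pre_digraph \<Rightarrow> nat" where
  "hom_count_upto k F G = (if vcount F \<le> k then hom_count F G else 0)"


section \<open>Treewidth\<close>

text \<open>
  The library predicates \<open>forest\<close> and \<open>tree\<close> forbid directed cycles; in a symmetric digraph an
  edge traversed back and forth is a directed cycle of length 2, so they do not describe
  undirected trees. Cycles of an undirected graph are the directed cycles of length at least 3.
\<close>

definition undirected_tree :: "'a pair_pre_digraph \<Rightarrow> bool" where
  "undirected_tree T \<longleftrightarrow> pair_graph T \<and> Digraph_Component.connected (with_proj T) \<and>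
     \<not> (\<exists>p. pre_digraph.cycle (with_proj T) p \<and> 3 \<le> length p)"

text \<open>
  The predicate \<open>Digraph_Component.connected\<close> includes nonemptiness.
\<close>

definition tree_decomposition ::
    "'a pair_pre_digraph \<Rightarrow> nat pair_pre_digraph \<Rightarrow> (nat \<Rightarrow> 'a set) \<Rightarrow> bool" where
  "tree_decomposition F T B \<longleftrightarrow>
     undirected_tree T \<and>
     (\<Union>t \<in> pverts T. B t) = pverts F \<and>
     (\<forall>(u, w) \<in> parcs F. \<exists>t \<in> pverts T. u \<in> B t \<and> w \<in> B t) \<and>
     (\<forall>u \<in> pverts F. Digraph_Component.connected (with_proj T \<restriction> {t \<in> pverts T. u \<in> B t}))"

definition decomposition_width :: "nat pair_pre_digraph \<Rightarrow> (nat \<Rightarrow> 'a set) \<Rightarrow> nat" where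
  "decomposition_width T B = Max ((\<lambda>t. card (B t)) ` pverts T) - 1"

definition treewidth :: "'a pair_pre_digraph \<Rightarrow> nat" where
  "treewidth F = (LEAST k. \<exists>T B. tree_decomposition F T B \<and> decomposition_width T B = k)"


section \<open>Random graph embeddings\<close>

text \<open>
  Vectors indexed by \<open>\<G> n\<close> are functions on graphs. Only unit vectors of elements of \<open>\<G> n\<close>
  are used, so all vectors vanish off \<open>\<G> n\<close>, and the expectation of a random vector is
  taken coordinatewise.
\<close>

definition unit_vec :: "ngraph \<Rightarrow> ngraph \<Rightarrow> real" where
  "unit_vec F = (\<lambda>H. if H = F then 1 else 0)"

definition hom_embedding :: "ngraph \<Rightarrow> ngraph \<Rightarrow> ngraph \<Rightarrow> real" where
  "hom_embedding F G = (\<lambda>H. real (hom_count_upto (vcount G) F G) * unit_vec F H)"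

definition mean_embedding ::
    "'x pmf \<Rightarrow> ('x \<Rightarrow> ngraph \<Rightarrow> ngraph \<Rightarrow> real) \<Rightarrow> ngraph \<Rightarrow> ngraph \<Rightarrow> real" where
  "mean_embedding D \<phi> G = (\<lambda>H. measure_pmf.expectation D (\<lambda>X. \<phi> X G H))"

definition expectation_complete ::
    "nat \<Rightarrow> 'x pmf \<Rightarrow> ('x \<Rightarrow> ngraph \<Rightarrow> ngraph \<Rightarrow> real) \<Rightarrow> bool" where
  "expectation_complete n D \<phi> \<longleftrightarrow>
     (\<forall>G \<in> graphs_upto n. \<forall>G' \<in> graphs_upto n.
        (isomorphic G G' \<longrightarrow> mean_embedding D \<phi> G = mean_embedding D \<phi> G') \<and>
        (\<not> isomorphic G G' \<longrightarrow> mean_embedding D \<phi> G \<noteq> mean_embedding D \<phi> G'))"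


section \<open>Running time\<close>

text \<open>
  The running time of an algorithm for homomorphism counts is a function of the pattern F and
  the graph G. The predicate is the bound of Diaz, Serna and Thilikos, with an
  absolute constant C.
\<close>

definition hom_time_bound :: "(ngraph \<Rightarrow> ngraph \<Rightarrow> nat) \<Rightarrow> real \<Rightarrow> bool" where
  "hom_time_bound hom_time C \<longleftrightarrow>
     (\<forall>F G. simple_graph F \<longrightarrow> simple_graph G \<longrightarrow>
        real (hom_time F G) \<le> C * real (vcount F) * real (vcount G) ^ (treewidth F + 1))"

text \<open>
  Computing the embedding of G for the pattern F costs one homomorphism count, or the constant
  c if F has more vertices than G.
\<close>

definition embedding_time ::
    "(ngraph \<Rightarrow> ngraph \<Rightarrow> nat) \<Rightarrow> nat \<Rightarrow> ngraph \<Rightarrow> ngraph \<Rightarrow> nat" where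
  "embedding_time hom_time c F G = (if vcount F \<le> vcount G then hom_time F G else c)"


section \<open>Isomorphism class representatives and trivial tree decompositions\<close>

lemma isomorphicI:
  assumes "pair_wf_digraph G" "inj_on f (pverts G)" "pverts H = f ` pverts G"
    and "parcs H = map_prod f f ` parcs G"
  shows "isomorphic G H"
proof -
  let ?h = "\<lparr>iso_verts = f, iso_arcs = map_prod f f, iso_head = snd, iso_tail = fst\<rparr>"
  interpret pair_wf_digraph G by fact
  have "parcs G \<subseteq> pverts G \<times> pverts G"
    using in_arcsD1 in_arcsD2 by auto
  then have "inj_on (map_prod f f) (parcs G)"
    using assms(2) by (intro inj_on_subset[OF map_prod_inj_on])
  then have "pre_digraph.digraph_isomorphism (with_proj G) ?h"
    using assms by (auto simp: pre_digraph.digraph_isomorphism_def wf_digraph_wp_iff)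
  moreover have "with_proj H = app_iso ?h (with_proj G)"
    using assms by (simp add: app_iso_def with_proj_def)
  ultimately show ?thesis
    unfolding isomorphic_def digraph_iso_def by blast
qed

lemma isomorphic_imp_bij:
  assumes "isomorphic G H"
  obtains f where "bij_betw f (pverts G) (pverts H)" "parcs H = map_prod f f ` parcs G"
proof -
  obtain h where h: "pre_digraph.digraph_isomorphism (with_proj G) h"
      and H: "with_proj H = app_iso h (with_proj G)"
    using assms unfolding isomorphic_def digraph_iso_def by blast
  have V: "pverts H = iso_verts h ` pverts G" and A: "parcs H = iso_arcs h ` parcs G"
    and "iso_tail h = fst" and "iso_head h = snd"
    using arg_cong[OF H, of verts] arg_cong[OF H, of arcs]
      arg_cong[OF H, of tail] arg_cong[OF H, of head] by simp_all
  then have "iso_arcs h a = map_prod (iso_verts h) (iso_verts h) a" if "a \<in> parcs G" for a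
    using h that by (auto simp: pre_digraph.digraph_isomorphism_def prod_eq_iff)
  then have "parcs H = map_prod (iso_verts h) (iso_verts h) ` parcs G"
    using A by (metis image_cong)
  moreover have "bij_betw (iso_verts h) (pverts G) (pverts H)"
    using h V by (auto simp: pre_digraph.digraph_isomorphism_def bij_betw_def)
  ultimately show thesis using that by blast
qed

lemma isomorphic_refl: "simple_graph G \<Longrightarrow> isomorphic G G"
  unfolding simple_graph_def
  by (intro isomorphicI[where f = id])
     (auto simp: pair_graph_def pair_digraph_def pair_fin_digraph_def map_prod.id)

lemma isomorphic_sym:
  assumes "simple_graph G" "isomorphic G H" shows "isomorphic H G"
proof -
  have "wf_digraph (with_proj G)"
    using assms(1) unfolding simple_graph_def
    by (simp add: wf_digraph_wp_iff pair_graph_def pair_digraph_def pair_fin_digraph_def)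
  then show ?thesis using assms(2) unfolding isomorphic_def by (rule digraph_iso_swap)
qed

lemma isomorphic_trans: "isomorphic G H \<Longrightarrow> isomorphic H K \<Longrightarrow> isomorphic G K"
  unfolding isomorphic_def by (rule digraph_iso_trans)

lemma isomorphic_vcount: "isomorphic G H \<Longrightarrow> vcount G = vcount H"
  unfolding vcount_def by (erule isomorphic_imp_bij) (rule bij_betw_same_card)

lemma canonical_props:
  assumes "simple_graph G"
  shows "simple_graph (canonical G)" "isomorphic G (canonical G)"
  using someI[of "\<lambda>H. simple_graph H \<and> isomorphic G H" G] assms isomorphic_refl[OF assms]
  unfolding canonical_def by auto

lemma isomorphic_iff_canonical:
  assumes "simple_graph G" "simple_graph G'"
  shows "isomorphic G G' \<longleftrightarrow> canonical G = canonical G'"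
proof
  assume "isomorphic G G'"
  then have "isomorphic G H \<longleftrightarrow> isomorphic G' H" for H :: ngraph
    using isomorphic_sym[OF assms(1)] isomorphic_trans by blast
  then show "canonical G = canonical G'" unfolding canonical_def by simp
next
  assume "canonical G = canonical G'"
  then show "isomorphic G G'"
    using canonical_props assms isomorphic_sym isomorphic_trans by metis
qed

lemma graph_reps_subset: "\<G> n \<subseteq> graphs_upto n"
  using canonical_props isomorphic_vcount by (fastforce simp: graph_reps_def graphs_upto_def)

lemma graph_reps_unique:
  assumes "G \<in> graphs_upto n" shows "\<exists>!H. H \<in> \<G> n \<and> isomorphic G H"
proof (intro ex1I[of _ "canonical G"] conjI)
  show "canonical G \<in> \<G> n" using assms by (simp add: graph_reps_def)
  show "isomorphic G (canonical G)"
    using assms canonical_props by (simp add: graphs_upto_def)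
  fix H assume H: "H \<in> \<G> n \<and> isomorphic G H"
  then obtain K where K: "K \<in> graphs_upto n" "H = canonical K" by (auto simp: graph_reps_def)
  then have "isomorphic K H" "simple_graph H"
    using canonical_props by (auto simp: graphs_upto_def)
  then have "canonical H = canonical K" "canonical G = canonical H"
    using K H assms isomorphic_iff_canonical by (auto simp: graphs_upto_def)
  with K show "H = canonical G" by simp
qed

lemma finite_graph_reps: "finite (\<G> n)"
proof -
  let ?S = "(\<lambda>(V, A). \<lparr>pverts = V, parcs = A\<rparr> :: ngraph)
    ` (Pow {..<n} \<times> Pow ({..<n} \<times> {..<n}))"
  have "\<G> n \<subseteq> canonical ` ?S"
  proof
    fix H assume "H \<in> \<G> n"
    then obtain G where G: "simple_graph G" "vcount G \<le> n" and H: "H = canonical G"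
      by (auto simp: graph_reps_def graphs_upto_def)
    interpret pair_graph G using G by (simp add: simple_graph_def)
    obtain f where f: "bij_betw f (pverts G) {..<vcount G}"
      using ex_bij_betw_finite_nat[OF pair_finite_verts]
      by (auto simp: vcount_def atLeast0LessThan)
    let ?K = "\<lparr>pverts = f ` pverts G, parcs = map_prod f f ` parcs G\<rparr>"
    have fin: "f u < n" if "u \<in> pverts G" for u
      using bij_betwE[OF f] that G(2) by fastforce
    have inj: "inj_on f (pverts G)" using f by (simp add: bij_betw_def)
    have wfG: "pair_wf_digraph G" by (rule pair_wf_digraph)
    have iso: "isomorphic G ?K"
      by (rule isomorphicI[where f = f]) (use wfG inj in auto)
    have "pair_graph ?K"
    proof
      show "symmetric (with_proj ?K)"
        using arcs_symmetric by (force simp: symmetric_def sym_def)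
      fix e assume "e \<in> parcs ?K"
      then obtain u w where uw: "(u, w) \<in> parcs G" "e = (f u, f w)" by auto
      then have "u \<noteq> w" "u \<in> pverts G" "w \<in> pverts G"
        using no_loops' in_arcsD1 in_arcsD2 by auto
      then show "fst e \<noteq> snd e" using inj uw by (auto dest: inj_onD)
    qed (use in_arcsD1 in_arcsD2 pair_finite_verts pair_finite_arcs in \<open>auto\<close>)
    then have "simple_graph ?K" using G by (simp add: simple_graph_def)
    then have "H = canonical ?K" using iso G H isomorphic_iff_canonical by blast
    moreover have "?K \<in> ?S"
      by (rule image_eqI[where x = "(f ` pverts G, map_prod f f ` parcs G)"])
         (use fin in_arcsD1 in_arcsD2 in \<open>auto\<close>)
    ultimately show "H \<in> canonical ` ?S" by blast
  qed
  then show ?thesis by (rule finite_subset) auto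
qed

lemma tree_decomposition_trivial:
  fixes F :: "'a pair_pre_digraph"
  assumes "simple_graph F"
  shows "tree_decomposition F \<lparr>pverts = {0}, parcs = {}\<rparr> (\<lambda>_. pverts F)"
proof -
  interpret F: pair_graph F using assms by (simp add: simple_graph_def)
  let ?T = "\<lparr>pverts = {0::nat}, parcs = {}\<rparr>"
  have pg: "pair_graph ?T" by unfold_locales (auto simp: symmetric_def)
  have con: "Digraph_Component.connected G" if "verts G = {0}" for G :: "(nat, nat \<times> nat) pre_digraph"
    using that by (simp add: connected_def strongly_connected_def mk_symmetric_def reachable_def)
  have no_cycle: "\<not> pre_digraph.cycle (with_proj ?T) p" for p
    by (auto simp: pre_digraph.cycle_def pre_digraph.awalk_def)
  show ?thesis
    using pg no_cycle F.in_arcsD1 F.in_arcsD2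
    by (auto simp: tree_decomposition_def undirected_tree_def intro!: con)
qed

lemma treewidth_less_vcount:
  assumes "simple_graph F" shows "treewidth F < vcount F"
proof -
  have "treewidth F \<le> decomposition_width \<lparr>pverts = {0}, parcs = {}\<rparr> (\<lambda>_. pverts F)"
    unfolding treewidth_def using tree_decomposition_trivial[OF assms] by (intro Least_le) blast
  moreover have "vcount F > 0"
    using assms by (auto simp: simple_graph_def vcount_def pair_graph_def pair_digraph_def
      card_gt_0_iff intro: pair_fin_digraph.pair_finite_verts)
  ultimately show ?thesis by (simp add: decomposition_width_def vcount_def)
qed

end

theory Submission
  imports Defs
begin

text \<open>
  Expectation completeness is Lovasz's theorem. A homomorphism from F factors through the quotient
  of F by its kernel, so the homomorphism counts from the graphs with at most k vertices determine,
  by induction on the number of vertices of F, the number of injective homomorphisms from F. Two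
  graphs of the same order that embed into each other are isomorphic. The coordinate of the
  one-vertex graph detects the order.

  For the running time, a pattern F with at most n vertices costs at most
  \<open>\<bar>C\<bar> * n ^ (n + 1)\<close> on a graph in \<open>\<G> n\<close>, since the treewidth of F is less than its order. The
  distribution may depend on n, so it can put mass at least \<open>1 - 1 / n ^ (n + 1)\<close> on the one-vertex
  pattern, whose cost is linear; the other patterns then contribute only a constant.
\<close>

section \<open>Homomorphism counts and isomorphism\<close>

lemma simple_graphD:
  assumes "simple_graph G"
  shows "finite (pverts G)" "finite (parcs G)" "pverts G \<noteq> {}"
    "(u, w) \<in> parcs G \<Longrightarrow> u \<in> pverts G" "(u, w) \<in> parcs G \<Longrightarrow> w \<in> pverts G"
    "(u, w) \<in> parcs G \<Longrightarrow> u \<noteq> w" "(u, w) \<in> parcs G \<Longrightarrow> (w, u) \<in> parcs G" "pair_wf_digraph G"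
proof -
  interpret G: pair_graph G using assms by (simp add: simple_graph_def)
  show "finite (pverts G)" "finite (parcs G)" "pair_wf_digraph G"
    by (rule G.pair_finite_verts G.pair_finite_arcs G.pair_wf_digraph)+
  show "(u, w) \<in> parcs G \<Longrightarrow> u \<in> pverts G" "(u, w) \<in> parcs G \<Longrightarrow> w \<in> pverts G"
    "(u, w) \<in> parcs G \<Longrightarrow> u \<noteq> w" "(u, w) \<in> parcs G \<Longrightarrow> (w, u) \<in> parcs G"
    using G.in_arcsD1 G.in_arcsD2 G.no_loops' G.arcs_symmetric by auto
  show "pverts G \<noteq> {}" using assms by (simp add: simple_graph_def)
qed

lemma vcount_pos: "simple_graph G \<Longrightarrow> vcount G > 0"
  by (simp add: vcount_def card_gt_0_iff simple_graphD(1,3))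

lemma finite_homs: "simple_graph F \<Longrightarrow> simple_graph G \<Longrightarrow> finite (homs F G)"
  unfolding homs_def by (simp add: finite_PiE simple_graphD(1))

text \<open>Universal property of the quotient: a homomorphism that is constant on the fibres of
  \<open>q\<close> factors uniquely through \<open>Q\<close>. The map \<open>q\<close> is general so
  that isomorphisms and quotients by kernels are both covered.\<close>

lemma bij_betw_homs_quotient:
  assumes F: "simple_graph F"
    and V: "pverts Q = q ` pverts F" and A: "parcs Q = map_prod q q ` parcs F"
  shows "bij_betw (\<lambda>g. restrict (g \<circ> q) (pverts F)) (homs Q H)
    {f \<in> homs F H. \<forall>u\<in>pverts F. \<forall>w\<in>pverts F. q u = q w \<longrightarrow> f u = f w}"
  unfolding bij_betw_def
proof (intro conjI equalityI subsetI)
  show "inj_on (\<lambda>g. restrict (g \<circ> q) (pverts F)) (homs Q H)"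
  proof (rule inj_onI)
    fix g g' assume *: "g \<in> homs Q H" "g' \<in> homs Q H"
      and eq: "restrict (g \<circ> q) (pverts F) = restrict (g' \<circ> q) (pverts F)"
    have "g (q u) = g' (q u)" if "u \<in> pverts F" for u
      using fun_cong[OF eq, of u] that by simp
    then show "g = g'"
      using * V by (intro PiE_ext[of g "pverts Q" "\<lambda>_. pverts H" g']) (auto simp: homs_def)
  qed
next
  fix f assume "f \<in> (\<lambda>g. restrict (g \<circ> q) (pverts F)) ` homs Q H"
  then obtain g where g: "g \<in> homs Q H" "f = restrict (g \<circ> q) (pverts F)" by blast
  have "(f u, f w) \<in> parcs H" if "(u, w) \<in> parcs F" for u w
    using g A that simple_graphD(4,5)[OF F that] by (force simp: homs_def)
  moreover have "f \<in> pverts F \<rightarrow>\<^sub>E pverts H" using g V by (auto simp: homs_def)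
  ultimately have "f \<in> homs F H" by (auto simp: homs_def)
  then show "f \<in> {f \<in> homs F H. \<forall>u\<in>pverts F. \<forall>w\<in>pverts F. q u = q w \<longrightarrow> f u = f w}"
    using g(2) by simp
next
  fix f assume f: "f \<in> {f \<in> homs F H. \<forall>u\<in>pverts F. \<forall>w\<in>pverts F. q u = q w \<longrightarrow> f u = f w}"
  then have hom: "f \<in> pverts F \<rightarrow>\<^sub>E pverts H" "\<And>u w. (u, w) \<in> parcs F \<Longrightarrow> (f u, f w) \<in> parcs H"
    and eq: "\<And>u w. u \<in> pverts F \<Longrightarrow> w \<in> pverts F \<Longrightarrow> q u = q w \<Longrightarrow> f u = f w"
    unfolding homs_def by blast+
  \<comment> \<open>Each value is read off at a chosen preimage; constancy on fibres makes the
    choice irrelevant, which is \<open>gq\<close>. The restriction supplies the default value that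
    \<open>homs\<close> demands outside \<open>pverts Q\<close>.\<close>
  define g where "g = restrict (\<lambda>x. f (inv_into (pverts F) q x)) (pverts Q)"
  have gq: "g (q u) = f u" if "u \<in> pverts F" for u
  proof -
    have "f (inv_into (pverts F) q (q u)) = f u"
      by (rule eq) (use that in \<open>auto intro: f_inv_into_f inv_into_into\<close>)
    then show ?thesis using that V by (simp add: g_def)
  qed
  have "g \<in> pverts Q \<rightarrow>\<^sub>E pverts H"
  proof (rule PiE_I)
    show "g x \<in> pverts H" if "x \<in> pverts Q" for x
      using that gq PiE_mem[OF hom(1)] unfolding V by auto
  qed (simp add: g_def)
  moreover have "(g u, g w) \<in> parcs H" if uw: "(u, w) \<in> parcs Q" for u w
  proof -
    obtain a b where "(a, b) \<in> parcs F" "u = q a" "w = q b" using uw unfolding A by auto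
    then show ?thesis using gq hom(2) simple_graphD(4,5)[OF F] by metis
  qed
  ultimately have "g \<in> homs Q H" unfolding homs_def by auto
  moreover have "f = restrict (g \<circ> q) (pverts F)"
  proof
    fix u show "f u = restrict (g \<circ> q) (pverts F) u"
      using gq PiE_arb[OF hom(1)] by (cases "u \<in> pverts F") simp_all
  qed
  ultimately show "f \<in> (\<lambda>g. restrict (g \<circ> q) (pverts F)) ` homs Q H"
    by (intro image_eqI[where x = g])
qed

lemma hom_count_isomorphic_left:
  assumes "simple_graph F" "isomorphic F F'"
  shows "hom_count F H = hom_count F' H"
proof -
  obtain q where q: "bij_betw q (pverts F) (pverts F')" "parcs F' = map_prod q q ` parcs F"
    using assms(2) by (rule isomorphic_imp_bij)
  \<comment> \<open>An isomorphism has one-point fibres, so the fibre condition is vacuous.\<close>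
  have "{f \<in> homs F H. \<forall>u\<in>pverts F. \<forall>w\<in>pverts F. q u = q w \<longrightarrow> f u = f w} = homs F H"
    using q(1) by (auto simp: bij_betw_def dest: inj_onD)
  then show ?thesis
    using bij_betw_same_card[OF bij_betw_homs_quotient[OF assms(1), of F' q H]] q
    by (simp add: hom_count_def bij_betw_def)
qed

lemma hom_count_isomorphic_right:
  fixes G G' :: "'b pair_pre_digraph"
  assumes F: "simple_graph F" and G: "simple_graph G" "simple_graph G'" "isomorphic G G'"
  shows "hom_count F G = hom_count F G'"
proof -
  \<comment> \<open>One inequality suffices, since it applies to the isomorphism and its inverse; it
    holds because composing with the injective \<open>q\<close> loses nothing.\<close>
  have "hom_count F H \<le> hom_count F H'"
    if H: "simple_graph H" "simple_graph H'" "isomorphic H H'" for H H' :: "'b pair_pre_digraph"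
  proof -
    obtain q where q: "bij_betw q (pverts H) (pverts H')" "parcs H' = map_prod q q ` parcs H"
      using H(3) by (rule isomorphic_imp_bij)
    have "(\<lambda>f. restrict (q \<circ> f) (pverts F)) ` homs F H \<subseteq> homs F H'"
    proof (intro image_subsetI)
      fix f assume "f \<in> homs F H"
      then have f: "f \<in> pverts F \<rightarrow>\<^sub>E pverts H" "\<And>u w. (u, w) \<in> parcs F \<Longrightarrow> (f u, f w) \<in> parcs H"
        by (auto simp: homs_def)
      have "(restrict (q \<circ> f) (pverts F) u, restrict (q \<circ> f) (pverts F) w) \<in> parcs H'"
        if "(u, w) \<in> parcs F" for u w
        using f(2)[OF that] simple_graphD(4,5)[OF F that] q(2) by auto
      then show "restrict (q \<circ> f) (pverts F) \<in> homs F H'"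
        using PiE_mem[OF f(1)] bij_betwE[OF q(1)] unfolding homs_def
        by (simp add: case_prod_unfold)
    qed
    moreover have "inj_on (\<lambda>f. restrict (q \<circ> f) (pverts F)) (homs F H)"
    proof (rule inj_onI)
      fix f f' assume *: "f \<in> homs F H" "f' \<in> homs F H"
        and eq: "restrict (q \<circ> f) (pverts F) = restrict (q \<circ> f') (pverts F)"
      have "f u = f' u" if "u \<in> pverts F" for u
      proof -
        have "q (f u) = q (f' u)" using fun_cong[OF eq, of u] that by simp
        moreover have "f u \<in> pverts H" "f' u \<in> pverts H" using * that by (auto simp: homs_def)
        ultimately show ?thesis using q(1) by (auto simp: bij_betw_def dest: inj_onD)
      qed
      then show "f = f'"
        using * by (intro PiE_ext[of f "pverts F" "\<lambda>_. pverts H" f']) (auto simp: homs_def)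
    qed
    ultimately show ?thesis
      unfolding hom_count_def using finite_homs[OF F H(2)] by (metis card_inj_on_le)
  qed
  from this[OF G] this[OF G(2,1) isomorphic_sym[OF G(1,3)]] show ?thesis by simp
qed


section \<open>Injective homomorphisms\<close>

definition inj_homs :: "'a pair_pre_digraph \<Rightarrow> 'b pair_pre_digraph \<Rightarrow> ('a \<Rightarrow> 'b) set" where
  "inj_homs F G = {f \<in> homs F G. inj_on f (pverts F)}"

text \<open>A relation on the source, so that kernels of maps into different graphs can be compared
  and one finite power set indexes them all.\<close>

definition hom_kernel :: "'a pair_pre_digraph \<Rightarrow> ('a \<Rightarrow> 'b) \<Rightarrow> ('a \<times> 'a) set" where
  "hom_kernel F f = {(u, w) \<in> pverts F \<times> pverts F. f u = f w}"

lemma hom_kernel_eq_iff: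
  "hom_kernel F f = hom_kernel F g \<longleftrightarrow>
     (\<forall>u\<in>pverts F. \<forall>w\<in>pverts F. f u = f w \<longleftrightarrow> g u = g w)"
proof
  assume eq: "hom_kernel F f = hom_kernel F g"
  show "\<forall>u\<in>pverts F. \<forall>w\<in>pverts F. f u = f w \<longleftrightarrow> g u = g w"
  proof (intro ballI)
    fix u w assume "u \<in> pverts F" "w \<in> pverts F"
    then have "f u = f w \<longleftrightarrow> (u, w) \<in> hom_kernel F f" "g u = g w \<longleftrightarrow> (u, w) \<in> hom_kernel F g"
      by (simp_all add: hom_kernel_def)
    then show "f u = f w \<longleftrightarrow> g u = g w" by (simp only: eq)
  qed
next
  assume "\<forall>u\<in>pverts F. \<forall>w\<in>pverts F. f u = f w \<longleftrightarrow> g u = g w"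
  then show "hom_kernel F f = hom_kernel F g"
    unfolding hom_kernel_def
    by (intro Collect_cong) (simp add: case_prod_unfold mem_Times_iff cong: conj_cong)
qed

lemma hom_kernel_eq_Id_iff: "hom_kernel F f = Id_on (pverts F) \<longleftrightarrow> inj_on f (pverts F)"
proof -
  have "hom_kernel F id = Id_on (pverts F)" by (auto simp: hom_kernel_def)
  then have "hom_kernel F f = Id_on (pverts F) \<longleftrightarrow> hom_kernel F f = hom_kernel F id" by simp
  also have "\<dots> \<longleftrightarrow> inj_on f (pverts F)"
    unfolding hom_kernel_eq_iff inj_on_def id_apply by blast
  finally show ?thesis .
qed

text \<open>The quotient bijection restricts: \<open>g \<circ> q\<close> has exactly the kernel of
  \<open>q\<close>, and not a larger one, iff \<open>g\<close> is injective.\<close>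

lemma card_homs_with_kernel:
  assumes F: "simple_graph F"
    and V: "pverts Q = q ` pverts F" and A: "parcs Q = map_prod q q ` parcs F"
  shows "card {f \<in> homs F H. hom_kernel F f = hom_kernel F q} = card (inj_homs Q H)"
proof -
  let ?\<Phi> = "\<lambda>g. restrict (g \<circ> q) (pverts F)"
  let ?A = "{f \<in> homs F H. \<forall>u\<in>pverts F. \<forall>w\<in>pverts F. q u = q w \<longrightarrow> f u = f w}"
  have bij: "bij_betw ?\<Phi> (homs Q H) ?A" by (rule bij_betw_homs_quotient[OF assms])
  have inj_iff: "inj_on g (pverts Q) \<longleftrightarrow> hom_kernel F (?\<Phi> g) = hom_kernel F q" for g :: "'b \<Rightarrow> 'c"
    unfolding hom_kernel_eq_iff V inj_on_def by auto
  have "?\<Phi> ` inj_homs Q H = {f \<in> ?A. hom_kernel F f = hom_kernel F q}"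
    unfolding bij_betw_imp_surj_on[OF bij, symmetric] inj_homs_def inj_iff by blast
  also have "\<dots> = {f \<in> homs F H. hom_kernel F f = hom_kernel F q}"
    unfolding hom_kernel_eq_iff by blast
  finally have "bij_betw ?\<Phi> (inj_homs Q H) {f \<in> homs F H. hom_kernel F f = hom_kernel F q}"
    using bij by (auto simp: bij_betw_def inj_homs_def intro: inj_on_subset)
  then show ?thesis by (simp add: bij_betw_same_card)
qed

text \<open>Identifying vertices of \<open>F\<close> could create a loop; the target rules this out,
  as the image of an edge is an edge of the loop-free \<open>G\<close>.\<close>

lemma simple_graph_hom_image:
  assumes F: "simple_graph F" and G: "simple_graph G" and f: "f \<in> homs F G"
  shows "simple_graph \<lparr>pverts = f ` pverts F, parcs = map_prod f f ` parcs F\<rparr>"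
proof -
  have "pair_graph \<lparr>pverts = f ` pverts F, parcs = map_prod f f ` parcs F\<rparr>" (is "pair_graph ?Q")
  proof
    show "symmetric (with_proj ?Q)"
      using simple_graphD(7)[OF F] by (force simp: symmetric_def sym_def)
    fix e assume "e \<in> parcs ?Q"
    then obtain u w where "(u, w) \<in> parcs F" "e = (f u, f w)" by auto
    then show "fst e \<noteq> snd e" using f simple_graphD(6)[OF G] by (auto simp: homs_def)
  qed (use simple_graphD[OF F] in \<open>auto\<close>)
  then show ?thesis using simple_graphD(3)[OF F] by (simp add: simple_graph_def)
qed

section \<open>Partition of the homomorphisms by their kernels\<close>

lemma hom_count_eq_sum_kernels:
  assumes "simple_graph F" "simple_graph G"
  shows "hom_count F G =
    (\<Sum>K \<in> Pow (pverts F \<times> pverts F). card {f \<in> homs F G. hom_kernel F f = K})"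
proof -
  have kernel: "hom_kernel F f \<in> Pow (pverts F \<times> pverts F)" for f :: "'a \<Rightarrow> 'b"
    by (auto simp: hom_kernel_def)
  \<comment> \<open>Relations that are not equivalences are indices too; their classes are empty and
    add zero.\<close>
  have "homs F G = (\<Union>K \<in> Pow (pverts F \<times> pverts F). {f \<in> homs F G. hom_kernel F f = K})"
    using kernel by blast
  then have "hom_count F G =
      card (\<Union>K \<in> Pow (pverts F \<times> pverts F). {f \<in> homs F G. hom_kernel F f = K})"
    unfolding hom_count_def by (rule arg_cong[where f = card])
  also have "\<dots> = (\<Sum>K \<in> Pow (pverts F \<times> pverts F). card {f \<in> homs F G. hom_kernel F f = K})"
    using assms by (intro card_UN_disjoint) (auto simp: finite_homs simple_graphD(1))
  finally show ?thesis .
qed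

text \<open>Strong induction on the order of \<open>F\<close>. Injective homomorphisms are those
  with diagonal kernel; every other kernel that occurs gives a smaller quotient, for which the
  counts agree by induction. Subtracting those classes from the equal totals leaves the injective
  ones.\<close>

lemma card_inj_homs_eq:
  fixes G G' :: ngraph
  assumes G: "simple_graph G" "simple_graph G'"
    and hom: "\<And>F :: ngraph. simple_graph F \<Longrightarrow> vcount F \<le> k \<Longrightarrow> hom_count F G = hom_count F G'"
    and F: "simple_graph F" "vcount F \<le> k"
  shows "card (inj_homs F G) = card (inj_homs (F :: ngraph) G')"
  using F
proof (induction "vcount F" arbitrary: F rule: less_induct)
  case less
  let ?c = "\<lambda>G K. card {f \<in> homs F (G :: ngraph). hom_kernel F f = K}"
  let ?I = "Id_on (pverts F)" and ?P = "Pow (pverts F \<times> pverts F)"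
  \<comment> \<open>\<open>H\<close> is whichever of \<open>G\<close> and \<open>G'\<close> receives
    \<open>q\<close>: one homomorphism into either makes the quotient simple, and the induction
    hypothesis then compares the counts into both.\<close>
  have image_case: "?c G (hom_kernel F q) = ?c G' (hom_kernel F q)"
    if q: "q \<in> homs F H" and H: "simple_graph H" and non_inj: "\<not> inj_on q (pverts F)"
    for q and H :: ngraph
  proof -
    let ?Q = "\<lparr>pverts = q ` pverts F, parcs = map_prod q q ` parcs F\<rparr>"
    have "card (q ` pverts F) < card (pverts F)"
      using non_inj simple_graphD(1)[OF less.prems(1)] card_image_le[of "pverts F" q]
      by (metis eq_card_imp_inj_on order_le_imp_less_or_eq)
    then have "vcount ?Q < vcount F" by (simp add: vcount_def)
    moreover have "simple_graph ?Q" by (rule simple_graph_hom_image[OF less.prems(1) H q])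
    ultimately have "card (inj_homs ?Q G) = card (inj_homs ?Q G')"
      using less.hyps less.prems by simp
    then show ?thesis
      using card_homs_with_kernel[OF less.prems(1), of ?Q q G]
        card_homs_with_kernel[OF less.prems(1), of ?Q q G'] by simp
  qed
  have "?c G K = ?c G' K" if "K \<noteq> ?I" for K
  proof (cases "\<exists>q \<in> homs F G \<union> homs F G'. hom_kernel F q = K")
    case True
    then obtain q H where "q \<in> homs F H" "simple_graph (H :: ngraph)" "K = hom_kernel F q"
      using G by blast
    then show ?thesis using image_case[of q H] that hom_kernel_eq_Id_iff by metis
  next
    case False
    then have "{f \<in> homs F G. hom_kernel F f = K} = {}" "{f \<in> homs F G'. hom_kernel F f = K} = {}"
      by auto
    then show ?thesis by (simp only:)
  qed
  then have rest: "sum (?c G) (?P - {?I}) = sum (?c G') (?P - {?I})" by (intro sum.cong) auto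
  have "?I \<in> ?P" "finite ?P" using simple_graphD(1)[OF less.prems(1)] by auto
  then have "hom_count F G = ?c G ?I + sum (?c G) (?P - {?I})"
    "hom_count F G' = ?c G' ?I + sum (?c G') (?P - {?I})"
    using hom_count_eq_sum_kernels[OF less.prems(1)] G by (simp_all add: sum.remove)
  then have "?c G ?I = ?c G' ?I" using hom[OF less.prems] rest by simp
  then show ?case by (simp add: inj_homs_def hom_kernel_eq_Id_iff)
qed

section \<open>From embeddings in both directions to isomorphism\<close>

lemma inj_homs_arcs:
  assumes F: "simple_graph F" and G: "simple_graph G" and f: "f \<in> inj_homs F G"
  shows "map_prod f f ` parcs F \<subseteq> parcs G" "card (map_prod f f ` parcs F) = card (parcs F)"
proof -
  show "map_prod f f ` parcs F \<subseteq> parcs G" using f by (auto simp: inj_homs_def homs_def)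
  have "parcs F \<subseteq> pverts F \<times> pverts F" using simple_graphD(4,5)[OF F] by auto
  moreover have "inj_on (map_prod f f) (pverts F \<times> pverts F)"
    using f by (intro map_prod_inj_on) (auto simp: inj_homs_def)
  ultimately show "card (map_prod f f ` parcs F) = card (parcs F)"
    using card_image inj_on_subset by blast
qed

text \<open>Equal orders make the injective \<open>f\<close> bijective on vertices. By
  \<open>g\<close>, \<open>G'\<close> has at most as many arcs as \<open>G\<close>, so the arcs of
  \<open>G\<close>, embedded by \<open>f\<close>, fill the finite arc set of
  \<open>G'\<close>.\<close>

lemma isomorphic_if_inj_homs:
  assumes G: "simple_graph G" "simple_graph G'" and card: "vcount G = vcount G'"
    and f: "f \<in> inj_homs G G'" and g: "g \<in> inj_homs G' G"
  shows "isomorphic G G'"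
proof (rule isomorphicI[where f = f])
  show "pair_wf_digraph G" by (rule simple_graphD(8)[OF G(1)])
  show inj: "inj_on f (pverts G)" using f by (simp add: inj_homs_def)
  have "f ` pverts G \<subseteq> pverts G'" using f by (auto simp: inj_homs_def homs_def)
  then show "pverts G' = f ` pverts G"
    using card_subset_eq[of "pverts G'" "f ` pverts G"] card inj simple_graphD(1)[OF G(2)]
    by (simp add: card_image vcount_def)
  note f_arcs = inj_homs_arcs[OF G f]
  note g_arcs = inj_homs_arcs[OF G(2,1) g]
  have "card (parcs G') \<le> card (parcs G)"
    using card_mono[OF simple_graphD(2)[OF G(1)] g_arcs(1)] g_arcs(2) by simp
  then show "parcs G' = map_prod f f ` parcs G"
    using card_seteq[OF simple_graphD(2)[OF G(2)] f_arcs(1)] f_arcs(2) by simp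
qed

text \<open>Lovasz's theorem for patterns no larger than the graphs, whose counts are exactly those
  that survive the truncation in \<open>hom_count_upto\<close>.\<close>

theorem isomorphic_if_hom_counts_eq:
  fixes G G' :: ngraph
  assumes G: "simple_graph G" "simple_graph G'" and card: "vcount G = vcount G'"
    and hom: "\<And>F :: ngraph. simple_graph F \<Longrightarrow> vcount F \<le> vcount G \<Longrightarrow>
      hom_count F G = hom_count F G'"
  shows "isomorphic G G'"
proof -
  have id: "restrict id (pverts H) \<in> inj_homs H H" if "simple_graph H" for H :: ngraph
    using simple_graphD(4,5)[OF that] by (auto simp: inj_homs_def homs_def inj_on_def)
  have fin: "finite (inj_homs H H')" if "simple_graph H" "simple_graph H'" for H H' :: ngraph
    using finite_homs[OF that] by (simp add: inj_homs_def)
  have eq: "card (inj_homs F G) = card (inj_homs F G')" if "simple_graph F" "vcount F \<le> vcount G" for F :: ngraph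
    using card_inj_homs_eq[OF G hom that] by blast
  \<comment> \<open>The identity makes the injective count from \<open>G\<close> into itself
    positive, hence also the one into \<open>G'\<close>; then the roles are exchanged.\<close>
  have "card (inj_homs G G') \<noteq> 0"
    using eq[of G] id[of G] fin[of G G] G by (metis card_0_eq empty_iff order_refl)
  moreover have "card (inj_homs G' G) \<noteq> 0"
    using eq[of G'] id[of G'] fin[of G' G'] G card by (metis card_0_eq empty_iff order_refl)
  ultimately obtain f g where "f \<in> inj_homs G G'" "g \<in> inj_homs G' G"
    by (metis card.empty ex_in_conv)
  then show ?thesis by (rule isomorphic_if_inj_homs[OF G card])
qed


section \<open>Expectation completeness\<close>

definition point_graph :: ngraph where
  "point_graph = \<lparr>pverts = {0}, parcs = {}\<rparr>"

lemma simple_graph_point: "simple_graph point_graph"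
proof -
  have "pair_graph point_graph"
    by unfold_locales (auto simp: symmetric_def point_graph_def)
  then show ?thesis by (simp add: simple_graph_def point_graph_def)
qed

lemma vcount_point: "vcount point_graph = 1"
  by (simp add: vcount_def point_graph_def)

lemma point_in_graphs_upto: "n \<ge> 1 \<Longrightarrow> point_graph \<in> graphs_upto n"
  by (simp add: graphs_upto_def simple_graph_point vcount_point)

lemma hom_count_point: "hom_count point_graph G = vcount G"
  by (simp add: hom_count_def homs_def vcount_def point_graph_def card_PiE)

text \<open>Only the draw \<open>X = F\<close> contributes to coordinate \<open>F\<close>, so
  different patterns never mix and a positive probability lets the count be read off.\<close>

lemma mean_hom_embedding:
  "mean_embedding D hom_embedding G F = pmf D F * real (hom_count_upto (vcount G) F G)"
proof -
  have "(\<lambda>X. hom_embedding X G F) =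
      (\<lambda>X. real (hom_count_upto (vcount G) F G) * indicator {F} X)"
    by (intro ext) (simp add: hom_embedding_def unit_vec_def split: split_indicator)
  then show ?thesis
    by (simp add: mean_embedding_def measure_pmf_single)
qed

lemma hom_count_canonical:
  assumes "simple_graph F"
  shows "hom_count (canonical F) G = hom_count F G"
  using hom_count_isomorphic_left[OF assms canonical_props(2)[OF assms]] by (rule sym)

lemma vcount_canonical: "simple_graph F \<Longrightarrow> vcount (canonical F) = vcount F"
  using canonical_props isomorphic_vcount by metis

lemma expectation_complete_hom_embedding:
  assumes n: "n \<ge> 1" and D: "set_pmf D = \<G> n"
  shows "expectation_complete n D hom_embedding"
  unfolding expectation_complete_def
proof (intro ballI conjI impI)
  fix G G' assume "G \<in> graphs_upto n" "G' \<in> graphs_upto n"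
  then have G: "simple_graph G" "simple_graph G'" "vcount G \<le> n" by (auto simp: graphs_upto_def)
  show "mean_embedding D hom_embedding G = mean_embedding D hom_embedding G'"
    if iso: "isomorphic G G'"
  proof
    fix F
    \<comment> \<open>Invariance of the count is applied on the support, where patterns are simple
      graphs; off it both coordinates vanish.\<close>
    have "hom_count F G = hom_count F G'" if "F \<in> set_pmf D"
      using that D graph_reps_subset hom_count_isomorphic_right[OF _ G(1,2) iso]
      by (auto simp: graphs_upto_def)
    then show "mean_embedding D hom_embedding G F = mean_embedding D hom_embedding G' F"
      using isomorphic_vcount[OF iso]
      by (cases "F \<in> set_pmf D") (simp_all add: mean_hom_embedding hom_count_upto_def pmf_eq_0_set_pmf)
  qed
  show "mean_embedding D hom_embedding G \<noteq> mean_embedding D hom_embedding G'"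
    if non_iso: "\<not> isomorphic G G'"
  proof
    assume eq: "mean_embedding D hom_embedding G = mean_embedding D hom_embedding G'"
    \<comment> \<open>Full support makes the factor \<open>pmf D (canonical F)\<close> nonzero, so
      it cancels.\<close>
    have upto: "hom_count_upto (vcount G) (canonical F) G = hom_count_upto (vcount G') (canonical F) G'"
      if "F \<in> graphs_upto n" for F
    proof -
      have "pmf D (canonical F) \<noteq> 0" using that D by (simp add: pmf_eq_0_set_pmf graph_reps_def)
      then show ?thesis using fun_cong[OF eq, of "canonical F"] by (simp add: mean_hom_embedding)
    qed
    \<comment> \<open>The truncation depends on the order of the graph, so orders are compared
      first. Every graph has a vertex, so the one-vertex pattern is never truncated.\<close>
    have card: "vcount G = vcount G'"
      using upto[OF point_in_graphs_upto[OF n]] G(1,2)[THEN vcount_pos] simple_graph_point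
      by (simp add: hom_count_upto_def hom_count_canonical vcount_canonical hom_count_point vcount_point Suc_leI)
    \<comment> \<open>Equal orders mean that \<open>F\<close> is truncated on neither side, and
      \<open>vcount G \<le> n\<close> puts its representative into the support.\<close>
    have "hom_count F G = hom_count F G'" if "simple_graph F" "vcount F \<le> vcount G" for F :: ngraph
      using upto[of F] that G(3) card
      by (simp add: graphs_upto_def hom_count_upto_def hom_count_canonical vcount_canonical)
    then show False using isomorphic_if_hom_counts_eq[OF G(1,2) card] non_iso by blast
  qed
qed


section \<open>Running time\<close>

lemma exists_concentrated_pmf:
  fixes \<epsilon> :: real
  assumes A: "finite A" "a \<in> A" and \<epsilon>: "\<epsilon> > 0"
  shows "\<exists>D. set_pmf D = A \<and> measure_pmf.prob D (- {a}) \<le> \<epsilon>"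
proof -
  \<comment> \<open>Weight of the uniform distribution in a mixture with the point mass at
    \<open>a\<close>. The cap \<open>1 / 2\<close> keeps it a probability below 1 for large
    \<open>\<epsilon>\<close>.\<close>
  define \<delta> where "\<delta> = min \<epsilon> (1 / 2)"
  have \<delta>: "0 < \<delta>" "\<delta> < 1" "\<delta> \<le> \<epsilon>" using \<epsilon> by (auto simp: \<delta>_def)
  let ?D = "bind_pmf (bernoulli_pmf \<delta>) (\<lambda>b. if b then pmf_of_set A else return_pmf a)"
  have "set_pmf (pmf_of_set A) = A" using A by (intro set_pmf_of_set) auto
  then have "set_pmf ?D = A" using A \<delta> by (auto simp: set_pmf_bernoulli UNIV_bool)
  moreover have "pmf ?D a = \<delta> * pmf (pmf_of_set A) a + (1 - \<delta>)"
    using \<delta> by (simp add: pmf_bind)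
  then have "pmf ?D a \<ge> 1 - \<delta>" using \<delta> by simp
  then have "measure_pmf.prob ?D (- {a}) \<le> \<epsilon>"
    using \<delta> measure_pmf.prob_compl[of "{a}" ?D] by (simp add: Compl_eq_Diff_UNIV measure_pmf_single)
  ultimately show ?thesis by blast
qed

text \<open>Raising the exponent \<open>treewidth F + 1\<close> to \<open>vcount F\<close> is
  monotone because the base is at least 1; \<open>C\<close> may have any sign, hence the absolute
  value.\<close>

lemma hom_time_le:
  assumes "hom_time_bound hom_time C" "simple_graph F" "simple_graph G"
  shows "real (hom_time F G) \<le> \<bar>C\<bar> * real (vcount F) * real (vcount G) ^ vcount F"
proof -
  have "real (hom_time F G) \<le> C * (real (vcount F) * real (vcount G) ^ (treewidth F + 1))"
    using assms by (simp add: hom_time_bound_def mult.assoc)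
  also have "\<dots> \<le> \<bar>C\<bar> * (real (vcount F) * real (vcount G) ^ vcount F)"
    using treewidth_less_vcount[OF assms(2)] vcount_pos[OF assms(3)]
    by (intro mult_mono power_increasing) auto
  finally show ?thesis by (simp add: mult.assoc)
qed

theorem theorem14:
  fixes hom_time :: "ngraph \<Rightarrow> ngraph \<Rightarrow> nat" and C :: real and c :: nat
  assumes "hom_time_bound hom_time C"
  shows "\<exists>p :: real poly. \<forall>n \<ge> 1. \<exists>D :: ngraph pmf.
           set_pmf D = \<G> n \<and>
           expectation_complete n D hom_embedding \<and>
           (\<forall>G \<in> graphs_upto n.
              measure_pmf.expectation D (\<lambda>F. real (embedding_time hom_time c F G))
                \<le> poly p (real (vcount G)))"
proof (intro exI[of _ "[:real c + \<bar>C\<bar>, \<bar>C\<bar>:]"] allI impI)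
  \<comment> \<open>In the polynomial, \<open>c\<close> pays for truncated patterns, the linear term
    for the one-vertex pattern, and the constant \<open>\<bar>C\<bar>\<close> for all other patterns
    together.\<close>
  fix n :: nat assume n: "n \<ge> 1"
  define K where "K = canonical point_graph"
  have K: "K \<in> \<G> n" using point_in_graphs_upto[OF n] by (simp add: K_def graph_reps_def)
  \<comment> \<open>\<open>n * n ^ n\<close> bounds \<open>vcount F * vcount G ^ vcount F\<close>
    when both orders are at most \<open>n\<close>.\<close>
  define M where "M = real n ^ (n + 1)"
  have "M > 0" using n by (simp add: M_def)
  then obtain D where D: "set_pmf D = \<G> n" "measure_pmf.prob D (- {K}) \<le> 1 / M"
    using exists_concentrated_pmf[OF finite_graph_reps K, of "1 / M"] by auto
  have "measure_pmf.expectation D (\<lambda>F. real (embedding_time hom_time c F G))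
      \<le> poly [:real c + \<bar>C\<bar>, \<bar>C\<bar>:] (real (vcount G))" if "G \<in> graphs_upto n" for G
  proof -
    from that have G: "simple_graph G" "vcount G \<le> n" by (auto simp: graphs_upto_def)
    have fin: "finite (set_pmf D)" by (simp add: D finite_graph_reps)
    \<comment> \<open>A majorant on the support that confines the large term to patterns other than
      \<open>K\<close>, so that its expectation carries the small probability.\<close>
    let ?t = "\<lambda>F. real c + \<bar>C\<bar> * real (vcount G) + \<bar>C\<bar> * M * indicator (- {K}) F"
    have time: "real (embedding_time hom_time c F G) \<le> ?t F" if "F \<in> set_pmf D" for F
    proof -
      have F: "simple_graph F" "vcount F \<le> n"
        using that D(1) graph_reps_subset by (auto simp: graphs_upto_def)
      note time = hom_time_le[OF assms F(1) G(1)]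
      show ?thesis
      proof (cases "F = K")
        case True
        \<comment> \<open>At order 1 the bound of \<open>hom_time_le\<close> is linear in
          \<open>vcount G\<close>.\<close>
        then have "vcount F = 1" by (simp add: K_def vcount_canonical simple_graph_point vcount_point)
        then show ?thesis using time True by (auto simp: embedding_time_def)
      next
        case False
        have "real (vcount G) ^ vcount F \<le> real n ^ vcount F"
          using G by (intro power_mono) auto
        also have "\<dots> \<le> real n ^ n" using F n by (intro power_increasing) auto
        finally have "\<bar>C\<bar> * (real (vcount F) * real (vcount G) ^ vcount F) \<le> \<bar>C\<bar> * M"
          unfolding M_def power_Suc Suc_eq_plus1[symmetric]
          using F by (intro mult_left_mono mult_mono) auto
        then have "real (hom_time F G) \<le> \<bar>C\<bar> * M" using time by (simp add: mult.assoc)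
        moreover have "real (embedding_time hom_time c F G) \<le> real c + real (hom_time F G)"
          by (simp add: embedding_time_def)
        moreover have "0 \<le> \<bar>C\<bar> * real (vcount G)" by simp
        ultimately have "real (embedding_time hom_time c F G)
            \<le> real c + \<bar>C\<bar> * real (vcount G) + \<bar>C\<bar> * M"
          by linarith
        then show ?thesis using False by simp
      qed
    qed
    have "measure_pmf.expectation D (\<lambda>F. real (embedding_time hom_time c F G))
        \<le> measure_pmf.expectation D ?t"
    proof (rule integral_mono_AE)
      show "AE F in measure_pmf D. real (embedding_time hom_time c F G) \<le> ?t F"
        using time by (rule AE_pmfI)
    qed (rule integrable_measure_pmf_finite[OF fin])+
    also have "\<dots> = real c + \<bar>C\<bar> * real (vcount G) + \<bar>C\<bar> * (M * measure_pmf.prob D (- {K}))"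
      using fin by (subst Bochner_Integration.integral_add)
        (auto intro: integrable_measure_pmf_finite)
    \<comment> \<open>The factor \<open>M\<close> cancels against \<open>1 / M\<close>, which
      removes \<open>n\<close> from the bound.\<close>
    also have "M * measure_pmf.prob D (- {K}) \<le> 1"
      using D(2) \<open>M > 0\<close> by (simp add: field_simps)
    then have "\<bar>C\<bar> * (M * measure_pmf.prob D (- {K})) \<le> \<bar>C\<bar>"
      using mult_left_mono[of _ 1 "\<bar>C\<bar>"] by simp
    finally show ?thesis by (simp add: algebra_simps)
  qed
  then show "\<exists>D :: ngraph pmf. set_pmf D = \<G> n \<and> expectation_complete n D hom_embedding \<and>
      (\<forall>G \<in> graphs_upto n.
        measure_pmf.expectation D (\<lambda>F. real (embedding_time hom_time c F G))
          \<le> poly [:real c + \<bar>C\<bar>, \<bar>C\<bar>:] (real (vcount G)))"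
    using D(1) expectation_complete_hom_embedding[OF n D(1)] by blast
qed

end
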